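(* Let $A\in\mathbb{R}^{n\times n}$ be a symmetric positive definite matrix, let $b\in\mathbb{R}^n$, and let $x_*\in\mathbb{R}^n$ be the exact solution of $Ax=b$. Let $v_1,\ldots,v_m\in\mathbb{R}^n$ be linearly independent vectors and let $V_m=[v_1,v_2,\ldots,v_m]\in\mathbb{R}^{n\times m}$. Let $x_k\in\mathbb{R}^n$ be an approximate solution of $Ax=b$ (i.e. an arbitrary vector), put $r_k=b-Ax_k$, and define $$x_{k+1}=x_k+V_m(V_m^TAV_m)^{-1}V_m^Tr_k .$$ Set $d_k=x_*-x_k$ and $d_{k+1}=x_*-x_{k+1}$. Then $$\|d_k\|_A\geq\|d_{k+1}\|_A .$$
   Context: For a symmetric positive definite matrix $M\in\mathbb{R}^{n\times n}$, the $M$-inner product is $\langle x,y\rangle_M=\langle Mx,y\rangle=y^TMx$, and the corresponding norm is $\|x\|_M=\langle x,x\rangle_M^{1/2}$. The matrix $V_m^TAV_m$ is symmetric positive definite, hence invertible, because $A$ is symmetric positive definite and the columns of $V_m$ are linearly independent. *)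

theory Defs
  imports "HOL-Analysis.Analysis"
begin

definition sym_pos_def :: "real^'n^'n \<Rightarrow> bool" where
  "sym_pos_def M \<longleftrightarrow> transpose M = M \<and> (\<forall>x. x \<noteq> 0 \<longrightarrow> 0 < (M *v x) \<bullet> x)"

definition mat_inner :: "real^'n^'n \<Rightarrow> real^'n \<Rightarrow> real^'n \<Rightarrow> real" where
  "mat_inner M x y = (M *v x) \<bullet> y"

definition mat_norm :: "real^'n^'n \<Rightarrow> real^'n \<Rightarrow> real" where
  "mat_norm M x = sqrt (mat_inner M x x)"

(* Rows are indexed by 'n and columns by 'm, so that column j (matrix_of_columns v) = v j. *)
definition matrix_of_columns :: "('m \<Rightarrow> real^'n) \<Rightarrow> real^'m^'n" where
  "matrix_of_columns v = (\<chi> i j. v j $ i)"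

(* Injectivity is needed because independent speaks about the set range v and so
   would ignore repeated vectors of the family v. *)
definition lin_indep_family :: "('m \<Rightarrow> real^'n) \<Rightarrow> bool" where
  "lin_indep_family v \<longleftrightarrow> inj v \<and> independent (range v)"

end

(* The correction w = V y satisfies the Galerkin condition transpose V A w = transpose V A d_k,
   so it is the A-orthogonal projection of d_k onto the range of V, and
   Pythagoras gives |d_k|^2 = |d_k1|^2 + |w|^2 in the A-norm. *)
theory Submission
  imports Defs
begin

text \<open>The product is the combination of the \<open>v j\<close> with coefficients
  \<open>z $ j\<close>, so linear independence forces each coefficient to vanish.\<close>

lemma matrix_of_columns_mult_eq_0:
  fixes v :: "'m::finite \<Rightarrow> real^'n"
  assumes "lin_indep_family v" "matrix_of_columns v *v z = 0"
  shows "z = 0"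
proof -
  have inj: "inj v" and ind: "independent (range v)"
    using assms(1) by (auto simp: lin_indep_family_def)
  have "column j (matrix_of_columns v) = v j" for j
    by (simp add: column_def matrix_of_columns_def vec_eq_iff)
  then have "(\<Sum>j\<in>UNIV. z $ j *\<^sub>R v j) = 0"
    using assms(2) by (simp add: matrix_mult_sum scalar_mult_eq_scaleR)
  \<comment> \<open>Independence of a set concerns sums indexed by the vectors themselves;
    injectivity of \<open>v\<close> lets \<open>inv v\<close> recover the index of each
    vector.\<close>
  then have "(\<Sum>x\<in>range v. z $ inv v x *\<^sub>R x) = 0"
    by (simp add: sum.reindex inj)
  then have "z $ inv v (v j) = 0" for j
    using independentD[OF ind, of "range v" "\<lambda>x. z $ inv v x" "v j"] by simp
  then show ?thesis
    using inj by (simp add: vec_eq_iff)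
qed

text \<open>The matrix is square, so a trivial kernel suffices. Pairing a kernel equation with
  \<open>z\<close> and moving \<open>transpose V\<close> across the inner product leaves the
  quadratic form of \<open>A\<close> at \<open>V *v z\<close>; definiteness makes this vector
  zero.\<close>

lemma invertible_compression:
  fixes A :: "real^'n^'n" and V :: "real^'m^'n"
  assumes "sym_pos_def A" "\<And>z. V *v z = 0 \<Longrightarrow> z = 0"
  shows "invertible (transpose V ** A ** V)"
proof -
  have "z = 0" if "(transpose V ** A ** V) *v z = 0" for z
  proof -
    have "transpose V *v (A *v (V *v z)) = 0"
      using that by (simp add: matrix_vector_mul_assoc matrix_mul_assoc)
    then have "(A *v (V *v z)) \<bullet> (V *v z) = 0"
      by (metis dot_lmul_matrix inner_zero_left transpose_matrix_vector)
    then show ?thesis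
      using assms unfolding sym_pos_def_def by (metis less_irrefl)
  qed
  then show ?thesis
    by (simp add: invertible_left_inverse matrix_left_invertible_ker)
qed

lemma mat_norm_diff_le:
  assumes "sym_pos_def A" "mat_inner A (d - w) w = 0"
  shows "mat_norm A (d - w) \<le> mat_norm A d"
proof -
  \<comment> \<open>Symmetry of \<open>A\<close> swaps the arguments, so both cross terms vanish
    when the form is expanded at \<open>d = (d - w) + w\<close>.\<close>
  have "mat_inner A w (d - w) = 0"
    using assms unfolding mat_inner_def sym_pos_def_def
    by (metis dot_lmul_matrix inner_commute transpose_matrix_vector)
  then have "mat_inner A d d = mat_inner A (d - w) (d - w) + mat_inner A w w"
    using assms(2)
    by (simp add: mat_inner_def matrix_vector_mult_diff_distrib inner_diff_left inner_diff_right)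
  moreover have "0 \<le> mat_inner A w w"
    using assms(1) by (cases "w = 0") (auto simp: sym_pos_def_def mat_inner_def less_imp_le)
  ultimately show ?thesis
    by (simp add: mat_norm_def)
qed

theorem theorem1:
  fixes A :: "real^'n^'n"
    and b x_star x_k x_k1 r_k d_k d_k1 :: "real^'n"
    and v :: "'m::finite \<Rightarrow> real^'n"
    and V :: "real^'m^'n"
  assumes "sym_pos_def A"
    and "A *v x_star = b"
    and "lin_indep_family v"
    and "V = matrix_of_columns v"
    and "r_k = b - A *v x_k"
    and "x_k1 = x_k + V *v (matrix_inv (transpose V ** A ** V) *v (transpose V *v r_k))"
    and "d_k = x_star - x_k"
    and "d_k1 = x_star - x_k1"
  shows "mat_norm A d_k \<ge> mat_norm A d_k1"
proof -
  define G where "G = transpose V ** A ** V"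
  define y where "y = matrix_inv G *v (transpose V *v r_k)"
  have r: "r_k = A *v d_k"
    using assms(2,5,7) by (simp add: matrix_vector_mult_diff_distrib)
  have d: "d_k1 = d_k - V *v y"
    using assms(6-8) by (simp add: y_def G_def)
  have "invertible G"
    unfolding G_def assms(4)
    by (rule invertible_compression[OF assms(1) matrix_of_columns_mult_eq_0[OF assms(3)]])
  \<comment> \<open>\<open>matrix_inv\<close> is a Hilbert choice, so its inverse property comes
    from the existence of some two-sided inverse.\<close>
  then have "G ** matrix_inv G = mat 1"
    unfolding invertible_def matrix_inv_def by (rule someI_ex[THEN conjunct1])
  then have "G *v y = transpose V *v r_k"
    by (simp add: y_def matrix_vector_mul_assoc matrix_mul_assoc)
  then have "transpose V *v (A *v (d_k - V *v y)) = 0"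
    by (simp add: G_def r matrix_vector_mult_diff_distrib matrix_vector_mul_assoc matrix_mul_assoc)
  \<comment> \<open>A vector killed by \<open>transpose V\<close> is orthogonal to the whole range
    of \<open>V\<close>, in particular to the correction \<open>V *v y\<close>.\<close>
  then have "mat_inner A (d_k - V *v y) (V *v y) = 0"
    unfolding mat_inner_def by (metis dot_lmul_matrix inner_zero_left transpose_matrix_vector)
  then show ?thesis
    using mat_norm_diff_le[OF assms(1)] d by simp
qed

end
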